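(* Let $0<c<1$ and let $\alpha_1,\alpha_2,\beta$ be real numbers with $\beta+1\notin\{0,-1,-2,\dots\}$, $\alpha_1\alpha_2(\beta+1)>0$, and such that the weight $$\rho(x)=\frac{(\alpha_1)_x(\alpha_2)_x}{(\beta+1)_x}\frac{c^x}{x!},\qquad x\in\mathbb{N}_0,$$ is positive for all $x\in\mathbb{N}_0$. Let $P_n^{(2,1)}$ denote its monic orthogonal polynomial of degree $n$ (generalized Hahn polynomial of type I). For $N\in\mathbb{N}$ let $$\rho_N(x)=\frac{(\alpha_1)_x(\alpha_2)_x(-N)_x}{(\beta+1)_x\left(-\frac{N}{c}+1\right)_x}\frac{1}{x!},\qquad x\in\{0,1,\dots,N\},$$ and, for $0\le n\le N$, let $P_{n,N}^{(3,2)}$ denote the monic orthogonal polynomial of degree $n$ with respect to $\rho_N$ (generalized Hahn polynomial of type II with parameters $\alpha_1,\alpha_2,-N$ and $\beta_1=\beta,\ \beta_2=-N/c$). Then for every $n\in\mathbb{N}_0$ and every $x$, $$\lim_{N\to\infty}P_{n,N}^{(3,2)}(x)=P_n^{(2,1)}(x).$$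
   Context: $(a)_x=a(a+1)\cdots(a+x-1)$, $(a)_0=1$, is the Pochhammer symbol, and $\mathbb{N}_0$ is the set of nonnegative integers. Given a positive weight $\rho$ with finite moments on a countable set $S\subset\mathbb{R}$, the monic orthogonal polynomials $P_n$ with respect to $\rho$ are the monic polynomials of degree $n$ (with $n<|S|$ if $S$ is finite) satisfying $\sum_{x\in S}P_n(x)x^k\rho(x)=0$ for $0\le k<n$. *)

theory Defs
  imports
    "HOL-Analysis.Infinite_Sum"
    "HOL-Computational_Algebra.Polynomial"
    "HOL-Library.Nonpos_Ints"
begin

text \<open>
  Discrete orthogonality on a set of lattice points \<open>S \<subseteq> \<nat>\<^sub>0\<close>, embedded in the reals by
  \<^const>\<open>real\<close>. Using \<^const>\<open>has_sum\<close> rather than \<^const>\<open>infsum\<close> makes convergence of the series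
  part of the condition (\<^const>\<open>infsum\<close> is \<open>0\<close> for a divergent series).
\<close>

definition is_monic_OP :: "nat set \<Rightarrow> (nat \<Rightarrow> real) \<Rightarrow> nat \<Rightarrow> real poly \<Rightarrow> bool" where
  "is_monic_OP S \<rho> n P \<longleftrightarrow>
     degree P = n \<and> lead_coeff P = 1 \<and>
     (\<forall>k<n. ((\<lambda>x. poly P (real x) * real x ^ k * \<rho> x) has_sum 0) S)"

text \<open>
  For a positive weight with finite moments the polynomial exists and is unique when
  \<open>S\<close> is infinite or \<open>n < card S\<close>; for other arguments the value is unspecified.
\<close>

definition monic_OP :: "nat set \<Rightarrow> (nat \<Rightarrow> real) \<Rightarrow> nat \<Rightarrow> real poly" where
  "monic_OP S \<rho> n = (THE P. is_monic_OP S \<rho> n P)"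

definition gen_hahn_I_weight :: "real \<Rightarrow> real \<Rightarrow> real \<Rightarrow> real \<Rightarrow> nat \<Rightarrow> real" where
  "gen_hahn_I_weight \<alpha>\<^sub>1 \<alpha>\<^sub>2 \<beta> c x =
     pochhammer \<alpha>\<^sub>1 x * pochhammer \<alpha>\<^sub>2 x / pochhammer (\<beta> + 1) x * (c ^ x / fact x)"

definition gen_hahn_II_weight ::
    "real \<Rightarrow> real \<Rightarrow> real \<Rightarrow> real \<Rightarrow> real \<Rightarrow> nat \<Rightarrow> real" where
  "gen_hahn_II_weight \<alpha>\<^sub>1 \<alpha>\<^sub>2 \<alpha>\<^sub>3 \<beta>\<^sub>1 \<beta>\<^sub>2 x =
     pochhammer \<alpha>\<^sub>1 x * pochhammer \<alpha>\<^sub>2 x * pochhammer \<alpha>\<^sub>3 x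
       / (pochhammer (\<beta>\<^sub>1 + 1) x * pochhammer (\<beta>\<^sub>2 + 1) x) * (1 / fact x)"

definition gen_hahn_I :: "real \<Rightarrow> real \<Rightarrow> real \<Rightarrow> real \<Rightarrow> nat \<Rightarrow> real poly" where
  "gen_hahn_I \<alpha>\<^sub>1 \<alpha>\<^sub>2 \<beta> c n = monic_OP UNIV (gen_hahn_I_weight \<alpha>\<^sub>1 \<alpha>\<^sub>2 \<beta> c) n"

definition gen_hahn_II :: "real \<Rightarrow> real \<Rightarrow> nat \<Rightarrow> real \<Rightarrow> real \<Rightarrow> nat \<Rightarrow> real poly" where
  "gen_hahn_II \<alpha>\<^sub>1 \<alpha>\<^sub>2 N \<beta>\<^sub>1 \<beta>\<^sub>2 n =
     monic_OP {0..N} (gen_hahn_II_weight \<alpha>\<^sub>1 \<alpha>\<^sub>2 (- real N) \<beta>\<^sub>1 \<beta>\<^sub>2) n"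

end

theory Submission
  imports Defs "HOL-Analysis.Uniform_Limit" "HOL-Real_Asymp.Real_Asymp"
begin

text \<open>
  The monic orthogonal polynomial of degree \<open>n\<close> arises from the moments of the weight by the
  Gram--Schmidt process, which divides only by the squared norms of the polynomials of lower degree.
  Hence convergence of all moments to those of a positive weight forces convergence of the
  orthogonal polynomials. The weights \<open>\<rho>\<^sub>N\<close> converge pointwise to \<open>\<rho>\<close> and are dominated by a
  constant multiple of \<open>\<rho>\<close>, so that the moments converge by Tannery's theorem.
\<close>

subsection \<open>Gram--Schmidt process for moment functionals\<close>

text \<open>Integration against a weight, but depending only on its moments \<open>m\<close>. Finite
  and infinite supports are thus treated alike, and a limit of weights becomes a limit of
  sequences.\<close>

definition moment_functional :: "(nat \<Rightarrow> real) \<Rightarrow> real poly \<Rightarrow> real" where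
  "moment_functional m p = (\<Sum>i\<le>degree p. coeff p i * m i)"

text \<open>A summation range independent of \<open>p\<close> allows several polynomials, or a whole
  family of them, to be treated at once; additivity and the passage to the limit rest on
  this.\<close>

lemma moment_functional_altdef:
  assumes "degree p \<le> d"
  shows "moment_functional m p = (\<Sum>i\<le>d. coeff p i * m i)"
  unfolding moment_functional_def
  by (rule sum.mono_neutral_left) (use assms in \<open>auto simp: coeff_eq_0\<close>)

lemma moment_functional_add:
  "moment_functional m (p + q) = moment_functional m p + moment_functional m q"
proof -
  define d where "d = max (degree p) (degree q)"
  have "degree (p + q) \<le> d" "degree p \<le> d" "degree q \<le> d"
    by (auto simp: d_def intro: degree_add_le)
  then show ?thesis
    by (simp add: moment_functional_altdef algebra_simps sum.distrib)
qed

lemma moment_functional_smult: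
  "moment_functional m (smult a p) = a * moment_functional m p"
  by (simp add: moment_functional_altdef[OF degree_smult_le]
      moment_functional_def sum_distrib_left algebra_simps)

lemma moment_functional_0 [simp]: "moment_functional m 0 = 0"
  by (simp add: moment_functional_def)

lemma moment_functional_diff:
  "moment_functional m (p - q) = moment_functional m p - moment_functional m q"
  using moment_functional_add[of m "p - q" q] by simp

lemma moment_functional_sum:
  "moment_functional m (\<Sum>i\<in>A. f i) = (\<Sum>i\<in>A. moment_functional m (f i))"
  by (induction A rule: infinite_finite_induct) (auto simp: moment_functional_add)

lemma poly_as_sum_smult_monom: "(\<Sum>i\<le>degree p. smult (coeff p i) (monom 1 i)) = p"
  for p :: "real poly"
  using poly_as_sum_of_monoms[of p] by (simp add: smult_monom)

text \<open>The polynomials are monic, not normalized, so their coefficients are rational in the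
  moments. For arbitrary \<open>m\<close> a squared norm can vanish; its quotient is then 0, so
  degree and leading coefficient are as expected in every case.\<close>

fun gram_schmidt :: "(nat \<Rightarrow> real) \<Rightarrow> nat \<Rightarrow> real poly" where
  "gram_schmidt m n = monom 1 n -
     (\<Sum>k<n. smult (moment_functional m (monom 1 n * gram_schmidt m k) /
                 moment_functional m (gram_schmidt m k * gram_schmidt m k)) (gram_schmidt m k))"

declare gram_schmidt.simps [simp del]

lemma degree_gram_schmidt_le: "degree (gram_schmidt m n) \<le> n"
proof (induction n rule: less_induct)
  case (less n)
  have "degree (gram_schmidt m k) \<le> n" if "k < n" for k
    using less[OF that] that by linarith
  then show ?case
    by (subst gram_schmidt.simps)
       (auto intro!: degree_diff_le degree_sum_le order.trans[OF degree_smult_le]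
             simp: degree_monom_eq simp del: degree_smult_eq)
qed

lemma coeff_gram_schmidt_self: "coeff (gram_schmidt m n) n = 1"
proof -
  have "coeff (gram_schmidt m k) n = 0" if "k < n" for k
    using that degree_gram_schmidt_le[of m k] by (intro coeff_eq_0) linarith
  then show ?thesis
    by (subst gram_schmidt.simps) (simp add: coeff_sum)
qed

lemma degree_gram_schmidt: "degree (gram_schmidt m n) = n"
  using degree_gram_schmidt_le[of m n] coeff_gram_schmidt_self[of m n]
  by (metis le_degree le_antisym zero_neq_one)

lemma gram_schmidt_neq_0: "gram_schmidt m n \<noteq> 0"
  using coeff_gram_schmidt_self[of m n] by auto

lemma gram_schmidt_orthogonal:
  assumes "\<And>k. k < n \<Longrightarrow> moment_functional m (gram_schmidt m k * gram_schmidt m k) \<noteq> 0"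
    and "j < n"
  shows "moment_functional m (gram_schmidt m n * gram_schmidt m j) = 0"
  using assms
proof (induction n arbitrary: j rule: less_induct)
  case (less n)
  let ?g = "gram_schmidt m" and ?L = "moment_functional m"
  \<comment> \<open>The induction hypothesis at \<open>k\<close> covers \<open>j < k\<close>; the
    other case uses it at \<open>j\<close> and the symmetry of the bilinear form. Only the term
    \<open>k = j\<close> of the projection sum survives.\<close>
  have orth: "?L (?g k * ?g j) = 0" if "k < n" "k \<noteq> j" for k
  proof (cases "j < k")
    case True
    then show ?thesis using less that by auto
  next
    case False
    then have "?L (?g j * ?g k) = 0" using less that by auto
    then show ?thesis by (simp add: mult.commute)
  qed
  have "?g n * ?g j = monom 1 n * ?g j -
      (\<Sum>k<n. smult (?L (monom 1 n * ?g k) / ?L (?g k * ?g k)) (?g k * ?g j))"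
    by (subst gram_schmidt.simps) (simp add: algebra_simps sum_distrib_left)
  then have "?L (?g n * ?g j) = ?L (monom 1 n * ?g j) -
      (\<Sum>k<n. ?L (monom 1 n * ?g k) / ?L (?g k * ?g k) * ?L (?g k * ?g j))"
    by (simp add: moment_functional_diff moment_functional_sum moment_functional_smult)
  also have "(\<Sum>k<n. ?L (monom 1 n * ?g k) / ?L (?g k * ?g k) * ?L (?g k * ?g j)) =
      (\<Sum>k\<in>{j}. ?L (monom 1 n * ?g k) / ?L (?g k * ?g k) * ?L (?g k * ?g j))"
    by (rule sum.mono_neutral_right) (use less.prems orth in auto)
  also have "\<dots> = ?L (monom 1 n * ?g j)"
    using less.prems by simp
  finally show ?case by simp
qed

text \<open>The recursion at index \<open>j\<close>, solved for the monomial, writes x^j as a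
  combination of the Gram--Schmidt polynomials of index at most \<open>j\<close>, all orthogonal to
  the one of index \<open>n\<close>.\<close>

lemma gram_schmidt_orthogonal_monom:
  assumes "\<And>k. k < n \<Longrightarrow> moment_functional m (gram_schmidt m k * gram_schmidt m k) \<noteq> 0"
    and "j < n"
  shows "moment_functional m (gram_schmidt m n * monom 1 j) = 0"
proof -
  let ?g = "gram_schmidt m" and ?L = "moment_functional m"
  define a where "a k = ?L (monom 1 j * ?g k) / ?L (?g k * ?g k)" for k
  have "monom 1 j = ?g j + (\<Sum>k<j. smult (a k) (?g k))"
    unfolding a_def by (subst gram_schmidt.simps) simp
  then have "?g n * monom 1 j = ?g n * ?g j + (\<Sum>k<j. smult (a k) (?g n * ?g k))"
    by (simp add: algebra_simps sum_distrib_left)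
  then show ?thesis
    using gram_schmidt_orthogonal[of n m, OF assms(1)] assms(2)
    by (simp add: moment_functional_add moment_functional_sum moment_functional_smult)
qed

section \<open>Continuity of the Gram--Schmidt polynomials in the moments\<close>

lemma tendsto_moment_functional:
  assumes "\<And>i. ((\<lambda>N. coeff (p N) i) \<longlongrightarrow> coeff q i) F"
    and "\<And>i. ((\<lambda>N. m N i) \<longlongrightarrow> m' i) F"
    and "\<And>N. degree (p N) \<le> d" and "degree q \<le> d"
  shows "((\<lambda>N. moment_functional (m N) (p N)) \<longlongrightarrow> moment_functional m' q) F"
  unfolding moment_functional_altdef[OF assms(3)] moment_functional_altdef[OF assms(4)]
  by (intro tendsto_intros assms)

text \<open>Besides ring operations the recursion only divides by squared norms, whose limits, the
  squared norms for \<open>m'\<close>, are nonzero.\<close>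

lemma tendsto_coeff_gram_schmidt:
  assumes m: "\<And>i. ((\<lambda>N. m N i) \<longlongrightarrow> m' i) F"
    and "\<And>k. k < n \<Longrightarrow> moment_functional m' (gram_schmidt m' k * gram_schmidt m' k) \<noteq> 0"
  shows "((\<lambda>N. coeff (gram_schmidt (m N) n) i) \<longlongrightarrow> coeff (gram_schmidt m' n) i) F"
  using assms(2)
proof (induction n arbitrary: i rule: less_induct)
  case (less n)
  have IH: "((\<lambda>N. coeff (gram_schmidt (m N) k) i) \<longlongrightarrow> coeff (gram_schmidt m' k) i) F"
    if "k < n" for k i
    using less that by auto
  \<comment> \<open>The factor \<open>r\<close> serves twice: as the constant family x^n for the
    numerators and as the Gram--Schmidt polynomial itself for the denominators.\<close>
  have *: "((\<lambda>N. moment_functional (m N) (r N * gram_schmidt (m N) k)) \<longlongrightarrow>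
             moment_functional m' (r' * gram_schmidt m' k)) F"
    if "k < n" "\<And>i. ((\<lambda>N. coeff (r N) i) \<longlongrightarrow> coeff r' i) F"
       "\<And>N. degree (r N) \<le> d" "degree r' \<le> d" for k r r' d
  proof (rule tendsto_moment_functional[OF _ m])
    show "((\<lambda>N. coeff (r N * gram_schmidt (m N) k) i) \<longlongrightarrow> coeff (r' * gram_schmidt m' k) i) F" for i
      unfolding coeff_mult by (intro tendsto_intros IH that)
    show "degree (r N * gram_schmidt (m N) k) \<le> d + k" for N
      using degree_mult_le[of "r N" "gram_schmidt (m N) k"] that(3)[of N]
      by (simp add: degree_gram_schmidt)
    show "degree (r' * gram_schmidt m' k) \<le> d + k"
      using degree_mult_le[of r' "gram_schmidt m' k"] that(4)
      by (simp add: degree_gram_schmidt)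
  qed
  show ?case
    unfolding gram_schmidt.simps[of _ n] coeff_diff coeff_sum coeff_smult
    by (intro tendsto_intros IH *[where d = n] *)
       (use less.prems in \<open>auto intro!: degree_monom_le IH simp: degree_gram_schmidt\<close>)
qed

subsection \<open>Orthogonal polynomials from moments\<close>

lemma has_sum_finite_sum:
  fixes f :: "'i \<Rightarrow> 'a \<Rightarrow> real"
  assumes "finite I" "\<And>i. i \<in> I \<Longrightarrow> (f i has_sum s i) S"
  shows "((\<lambda>x. \<Sum>i\<in>I. f i x) has_sum (\<Sum>i\<in>I. s i)) S"
  using assms by (induction I rule: finite_induct) (auto intro: has_sum_add)

lemma has_sum_moment_functional:
  assumes "\<And>k. ((\<lambda>x. real x ^ k * w x) has_sum m k) S"
  shows "((\<lambda>x. poly p (real x) * w x) has_sum moment_functional m p) S"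
proof -
  have "((\<lambda>x. \<Sum>i\<le>degree p. coeff p i * (real x ^ i * w x)) has_sum
          (\<Sum>i\<le>degree p. coeff p i * m i)) S"
    by (intro has_sum_finite_sum has_sum_cmult_right assms) auto
  then show ?thesis
    by (simp add: moment_functional_def poly_altdef sum_distrib_right mult.assoc)
qed

text \<open>A sum of nonnegative terms that is at most 0 has only zero terms, so \<open>p\<close>
  would vanish on all of \<open>S\<close>, which has more points than \<open>p\<close> can have
  roots.\<close>

lemma moment_functional_square_pos:
  assumes m: "\<And>k. ((\<lambda>x. real x ^ k * w x) has_sum m k) S"
    and w: "\<And>x. x \<in> S \<Longrightarrow> w x > 0"
    and S: "infinite S \<or> degree p < card S" and p: "p \<noteq> 0"
  shows "moment_functional m (p * p) > 0"
proof (rule ccontr)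
  assume "\<not> ?thesis"
  then have le: "moment_functional m (p * p) \<le> 0" by simp
  have nn: "poly (p * p) (real x) * w x \<ge> 0" if "x \<in> S" for x
    using w[OF that] by simp
  have "poly (p * p) (real x) * w x = 0" if "x \<in> S" for x
    using nonneg_has_sum_le_0D[OF has_sum_moment_functional[OF m, of "p * p"] le] nn that by blast
  then have sub: "real ` S \<subseteq> {x. poly p x = 0}"
    using w by force
  have fin: "finite {x. poly p x = 0}"
    using p by (rule poly_roots_finite)
  have "finite S"
    using finite_subset[OF sub fin] by (rule finite_imageD) simp
  moreover have "card S \<le> degree p"
    using card_mono[OF fin sub] card_poly_roots_bound[OF p] by (simp add: card_image)
  ultimately show False
    using S by simp
qed

lemma gram_schmidt_square_neq_0:
  assumes m: "\<And>k. ((\<lambda>x. real x ^ k * w x) has_sum m k) S"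
    and w: "\<And>x. x \<in> S \<Longrightarrow> w x > 0"
    and S: "infinite S \<or> n < card S"
  shows "moment_functional m (gram_schmidt m n * gram_schmidt m n) \<noteq> 0"
proof -
  have "moment_functional m (gram_schmidt m n * gram_schmidt m n) > 0"
  proof (rule moment_functional_square_pos)
    show "infinite S \<or> degree (gram_schmidt m n) < card S"
      using S by (simp add: degree_gram_schmidt)
  qed (fact m w gram_schmidt_neq_0)+
  then show ?thesis by simp
qed

text \<open>Existence is Gram--Schmidt. For uniqueness, the difference of two solutions has degree
  below \<open>n\<close>, hence is orthogonal to itself, against positivity of squared
  norms.\<close>

lemma monic_OP_eq_gram_schmidt:
  assumes m: "\<And>k. ((\<lambda>x. real x ^ k * w x) has_sum m k) S"
    and w: "\<And>x. x \<in> S \<Longrightarrow> w x > 0"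
    and S: "infinite S \<or> n < card S"
  shows "monic_OP S w n = gram_schmidt m n"
proof -
  have L: "((\<lambda>x. poly p (real x) * real x ^ k * w x) has_sum
             moment_functional m (p * monom 1 k)) S" for p k
    using has_sum_moment_functional[OF m, of "p * monom 1 k"] by (simp add: poly_monom)
  have OP_iff: "is_monic_OP S w n p \<longleftrightarrow> degree p = n \<and> lead_coeff p = 1 \<and>
      (\<forall>k<n. moment_functional m (p * monom 1 k) = 0)" for p
  proof -
    have "((\<lambda>x. poly p (real x) * real x ^ k * w x) has_sum 0) S \<longleftrightarrow>
        moment_functional m (p * monom 1 k) = 0" for k
      by (metis L[of p k] has_sum_unique)
    then show ?thesis by (simp add: is_monic_OP_def)
  qed
  have "moment_functional m (gram_schmidt m k * gram_schmidt m k) \<noteq> 0" if "k < n" for k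
  proof (rule gram_schmidt_square_neq_0)
    show "infinite S \<or> k < card S" using S that by linarith
  qed (fact m w)+
  then have gs: "is_monic_OP S w n (gram_schmidt m n)"
    by (simp add: OP_iff degree_gram_schmidt coeff_gram_schmidt_self
        gram_schmidt_orthogonal_monom)
  have "p = gram_schmidt m n" if p: "is_monic_OP S w n p" for p
  proof (rule ccontr)
    assume neq: "p \<noteq> gram_schmidt m n"
    define q where "q = p - gram_schmidt m n"
    have q0: "q \<noteq> 0" using neq by (simp add: q_def)
    have "degree q \<le> n"
      using p by (auto simp: q_def OP_iff degree_gram_schmidt intro!: degree_diff_le)
    moreover have "coeff q n = 0"
      using p by (auto simp: q_def OP_iff coeff_gram_schmidt_self)
    ultimately have deg: "degree q < n"
      using q0 by (metis le_neq_implies_less leading_coeff_0_iff)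
    have "moment_functional m (q * q) =
        moment_functional m (q * (\<Sum>i\<le>degree q. smult (coeff q i) (monom 1 i)))"
      by (simp only: poly_as_sum_smult_monom)
    also have "\<dots> = (\<Sum>i\<le>degree q. coeff q i * moment_functional m (q * monom 1 i))"
      by (simp only: sum_distrib_left moment_functional_sum mult_smult_right moment_functional_smult)
    also have "\<dots> = 0"
      using p gs deg
      by (intro sum.neutral) (auto simp: OP_iff q_def left_diff_distrib moment_functional_diff)
    finally have "moment_functional m (q * q) = 0" .
    moreover have "moment_functional m (q * q) > 0"
    proof (rule moment_functional_square_pos)
      show "infinite S \<or> degree q < card S" using S deg by linarith
    qed (fact m w q0)+
    ultimately show False by simp
  qed
  then show ?thesis
    unfolding monic_OP_def by (intro the_equality gs)
qed

text \<open>Positivity and the size of the support are required only eventually: a support with at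
  most \<open>n\<close> points does not determine the polynomial of degree \<open>n\<close>.\<close>

lemma tendsto_monic_OP:
  fixes w :: "nat \<Rightarrow> real" and wN :: "'a \<Rightarrow> nat \<Rightarrow> real"
    and m :: "nat \<Rightarrow> real" and mN :: "'a \<Rightarrow> nat \<Rightarrow> real" and x :: real
  assumes m: "\<And>k. ((\<lambda>x. real x ^ k * w x) has_sum m k) S"
    and w: "\<And>x. x \<in> S \<Longrightarrow> w x > 0"
    and S: "infinite S \<or> n < card S"
    and mN: "\<And>N k. ((\<lambda>x. real x ^ k * wN N x) has_sum mN N k) (SN N)"
    and wN: "eventually (\<lambda>N. \<forall>x\<in>SN N. wN N x > 0) F"
    and SN: "eventually (\<lambda>N. infinite (SN N) \<or> n < card (SN N)) F"
    and lim: "\<And>k. ((\<lambda>N. mN N k) \<longlongrightarrow> m k) F"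
  shows "((\<lambda>N. poly (monic_OP (SN N) (wN N) n) x) \<longlongrightarrow> poly (monic_OP S w n) x) F"
proof -
  have nz: "moment_functional m (gram_schmidt m k * gram_schmidt m k) \<noteq> 0" if "k < n" for k
  proof (rule gram_schmidt_square_neq_0)
    show "infinite S \<or> k < card S" using S that by linarith
  qed (fact m w)+
  have "((\<lambda>N. poly (gram_schmidt (mN N) n) x) \<longlongrightarrow> poly (gram_schmidt m n) x) F"
    unfolding poly_altdef degree_gram_schmidt
    by (intro tendsto_intros tendsto_coeff_gram_schmidt lim nz)
  moreover have "eventually (\<lambda>N. poly (gram_schmidt (mN N) n) x =
      poly (monic_OP (SN N) (wN N) n) x) F"
    using wN SN
  proof eventually_elim
    case (elim N)
    show ?case
      using monic_OP_eq_gram_schmidt[where w = "wN N" and S = "SN N", OF mN] elim by simp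
  qed
  ultimately have "((\<lambda>N. poly (monic_OP (SN N) (wN N) n) x) \<longlongrightarrow> poly (gram_schmidt m n) x) F"
    by (rule Lim_transform_eventually)
  then show ?thesis
    using monic_OP_eq_gram_schmidt[OF m w S] by simp
qed

subsection \<open>Moments of the generalized Hahn weights\<close>

lemma gen_hahn_I_weight_Suc:
  "gen_hahn_I_weight \<alpha>\<^sub>1 \<alpha>\<^sub>2 \<beta> c (Suc k) = gen_hahn_I_weight \<alpha>\<^sub>1 \<alpha>\<^sub>2 \<beta> c k *
     ((\<alpha>\<^sub>1 + k) * (\<alpha>\<^sub>2 + k) * c / ((\<beta> + 1 + k) * (real k + 1)))"
  by (simp add: gen_hahn_I_weight_def pochhammer_Suc field_simps)

lemma summable_gen_hahn_I_moment:
  assumes "0 < c" and "c < 1"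
  shows "summable (\<lambda>x. real x ^ k * gen_hahn_I_weight \<alpha>\<^sub>1 \<alpha>\<^sub>2 \<beta> c x)"
proof -
  let ?w = "gen_hahn_I_weight \<alpha>\<^sub>1 \<alpha>\<^sub>2 \<beta> c"
  \<comment> \<open>The quotient of consecutive terms, which tends to \<open>c\<close> for every
    \<open>k\<close>. It divides by \<open>real x\<close>, hence the ratio test starts at
    \<open>Suc M\<close>; the bound \<open>(1 + c) / 2\<close> is the midpoint of \<open>c\<close>
    and 1.\<close>
  define r where "r x = ((real x + 1) / real x) ^ k *
     ((\<alpha>\<^sub>1 + x) * (\<alpha>\<^sub>2 + x) * c / ((\<beta> + 1 + x) * (real x + 1)))" for x :: nat
  have "(\<lambda>x::nat. (real x + 1) / real x) \<longlonglongrightarrow> 1"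
    by real_asymp
  moreover have "(\<lambda>x::nat. (\<alpha>\<^sub>1 + x) * (\<alpha>\<^sub>2 + x) * c / ((\<beta> + 1 + x) * (real x + 1))) \<longlonglongrightarrow> c"
    using assms by real_asymp
  ultimately have "r \<longlonglongrightarrow> 1 ^ k * c"
    unfolding r_def by (intro tendsto_intros)
  then have "(\<lambda>x. \<bar>r x\<bar>) \<longlonglongrightarrow> c"
    using tendsto_rabs[of r c] assms by simp
  moreover have "c < (1 + c) / 2" using assms by simp
  ultimately have "eventually (\<lambda>x. \<bar>r x\<bar> < (1 + c) / 2) sequentially"
    by (rule order_tendstoD)
  then obtain M where M: "\<And>x. x \<ge> M \<Longrightarrow> \<bar>r x\<bar> < (1 + c) / 2"
    unfolding eventually_sequentially by blast
  show ?thesis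
  proof (rule summable_ratio_test)
    show "(1 + c) / 2 < 1" using assms by simp
    fix x assume x: "x \<ge> Suc M"
    have "real (Suc x) ^ k * ?w (Suc x) = r x * (real x ^ k * ?w x)"
      using x by (simp add: gen_hahn_I_weight_Suc r_def power_divide add.commute)
    then show "norm (real (Suc x) ^ k * ?w (Suc x)) \<le> (1 + c) / 2 * norm (real x ^ k * ?w x)"
      using mult_right_mono[OF less_imp_le[OF M[OF Suc_leD[OF x]]], of "norm (real x ^ k * ?w x)"]
      by (simp only: abs_mult[of "r x"] real_norm_def abs_ge_zero)
  qed
qed

section \<open>Comparison of the two weights\<close>

text \<open>Collects the whole dependence on \<open>N\<close> in one factor, which is then shown to
  be positive, to tend to 1 and to be bounded uniformly.\<close>

lemma gen_hahn_II_weight_eq: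
  assumes "c \<noteq> 0"
  shows "gen_hahn_II_weight \<alpha>\<^sub>1 \<alpha>\<^sub>2 \<alpha>\<^sub>3 \<beta> \<beta>\<^sub>2 x =
    gen_hahn_I_weight \<alpha>\<^sub>1 \<alpha>\<^sub>2 \<beta> c x * (pochhammer \<alpha>\<^sub>3 x / pochhammer (\<beta>\<^sub>2 + 1) x / c ^ x)"
  using assms by (simp add: gen_hahn_II_weight_def gen_hahn_I_weight_def mult_ac)

lemma gen_hahn_II_weight_eq_0:
  assumes "x > N"
  shows "gen_hahn_II_weight \<alpha>\<^sub>1 \<alpha>\<^sub>2 (- real N) \<beta> \<beta>\<^sub>2 x = 0"
  using assms by (simp add: gen_hahn_II_weight_def pochhammer_of_nat_eq_0_lemma)

text \<open>Passing from \<open>x\<close> to \<open>Suc x\<close> multiplies by a quotient of two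
  negative numbers, because x + 1 \<le> N < N/c.\<close>

lemma hahn_ratio_pos:
  fixes c :: real
  assumes "0 < c" and "c < 1" and "x \<le> N"
  shows "pochhammer (- real N) x / pochhammer (- real N / c + 1) x / c ^ x > 0"
  using assms(3)
proof (induction x)
  case (Suc x)
  have "real N * c < real N * 1"
    using assms Suc.prems by (intro mult_strict_left_mono) auto
  then have "real N / c > real N"
    using assms by (simp add: field_simps)
  then have "- real N / c + 1 + x < 0" and "- real N + x < 0"
    using Suc.prems by simp_all
  then have "(- real N + x) / (- real N / c + 1 + x) / c > 0"
    using assms by (intro divide_pos_pos divide_neg_neg)
  then have "pochhammer (- real N) x / pochhammer (- real N / c + 1) x / c ^ x *
     ((- real N + x) / (- real N / c + 1 + x) / c) > 0"
    using Suc by (intro mult_pos_pos) auto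
  then show ?case
    by (simp add: pochhammer_Suc mult_ac)
qed auto

text \<open>For fixed \<open>x\<close> this is a product of \<open>x\<close> factors, each tending
  to (-1) / (-1/c) / c = 1.\<close>

lemma tendsto_hahn_ratio:
  fixes c :: real
  assumes "0 < c"
  shows "(\<lambda>N. pochhammer (- real N) x / pochhammer (- real N / c + 1) x / c ^ x) \<longlonglongrightarrow> 1"
proof (induction x)
  case (Suc x)
  have "(\<lambda>N::nat. (- real N + x) / (- real N / c + 1 + x) / c) \<longlonglongrightarrow> 1"
    using assms by real_asymp
  from tendsto_mult[OF Suc this]
  have "(\<lambda>N. pochhammer (- real N) x / pochhammer (- real N / c + 1) x / c ^ x *
      ((- real N + x) / (- real N / c + 1 + x) / c)) \<longlonglongrightarrow> 1"
    by simp
  then show ?case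
    by (simp add: pochhammer_Suc mult_ac)
qed auto

text \<open>
  The factor of index \<open>j\<close> of the ratio is \<open>(N - j) / (N - c - c j)\<close>: it is at most \<open>1\<close> if
  \<open>j \<ge> c / (1 - c)\<close>, and at most \<open>1 / (1 - c)\<close> in any case.
\<close>

lemma hahn_ratio_le:
  fixes c :: real
  assumes c: "0 < c" "c < 1" and J: "c / (1 - c) \<le> real J" and "x \<le> N"
  shows "pochhammer (- real N) x / pochhammer (- real N / c + 1) x / c ^ x \<le> (1 / (1 - c)) ^ J"
proof -
  let ?q = "\<lambda>x. pochhammer (- real N) x / pochhammer (- real N / c + 1) x / c ^ x"
  \<comment> \<open>The exponent counts the factors of index below \<open>J\<close>, the only ones
    that may exceed 1.\<close>
  have "?q x \<le> (1 / (1 - c)) ^ min x J"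
    using assms(4)
  proof (induction x)
    case (Suc x)
    define t where "t = (- real N + x) / (- real N / c + 1 + x) / c"
    have xN: "real x + 1 \<le> real N" using Suc.prems by linarith
    have "c * (real x + 1) \<le> c * real N"
      using c xN by (intro mult_left_mono) auto
    moreover have "c * real N < 1 * real N"
      using c xN by (intro mult_strict_right_mono) auto
    ultimately have den: "real N - c - c * real x > 0"
      by (simp add: algebra_simps)
    have "t = (- real N + x) / ((- real N / c + 1 + x) * c)"
      by (simp add: t_def)
    also have "(- real N / c + 1 + x) * c = - (real N - c - c * real x)"
      using c by (simp add: algebra_simps)
    also have "(- real N + x) / - (real N - c - c * real x) = (real N - x) / (real N - c - c * real x)"
      by (metis minus_add_distrib minus_divide_divide add.inverse_inverse uminus_add_conv_diff add_uminus_conv_diff)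
    finally have t: "t = (real N - x) / (real N - c - c * real x)" .
    have t0: "t \<ge> 0" using t den xN by simp
    have t_le: "t \<le> 1 / (1 - c)"
    proof -
      have "c * (real x + 1) \<le> c * real N"
        using c xN by (intro mult_left_mono) auto
      moreover have "0 \<le> (1 - c) * real x" and "0 \<le> c * real x"
        using c by auto
      ultimately have "(real N - x) * (1 - c) \<le> real N - c - c * real x"
        by (simp add: algebra_simps)
      then show ?thesis
        using den c by (simp add: t divide_simps)
    qed
    have t_le1: "t \<le> 1" if "J \<le> x"
    proof -
      have "c / (1 - c) \<le> real x" using J that by linarith
      then have "c \<le> real x * (1 - c)" using c by (simp add: field_simps)
      then show ?thesis using den by (simp add: t algebra_simps)
    qed
    have "?q (Suc x) = ?q x * t"
      by (simp add: pochhammer_Suc t_def)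
    also have "\<dots> \<le> (1 / (1 - c)) ^ min x J * t"
      using Suc t0 by (intro mult_right_mono) auto
    also have "\<dots> \<le> (1 / (1 - c)) ^ min (Suc x) J"
    proof (cases "J \<le> x")
      case True
      then show ?thesis
        using mult_left_mono[OF t_le1[OF True], of "(1 / (1 - c)) ^ J"] c by simp
    next
      case False
      then show ?thesis
        using mult_left_mono[OF t_le, of "(1 / (1 - c)) ^ x"] c by simp
    qed
    finally show ?case .
  qed auto
  also have "\<dots> \<le> (1 / (1 - c)) ^ J"
    using c by (intro power_increasing) auto
  finally show ?thesis .
qed

text \<open>Since the type II weight vanishes beyond \<open>N\<close>, its moments are series over
  all naturals. Tannery's theorem then applies with a constant multiple of the type I moment series
  as majorant.\<close>

lemma gen_hahn_II_moment_tendsto: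
  fixes \<alpha>\<^sub>1 \<alpha>\<^sub>2 \<beta> c :: real
  assumes c: "0 < c" "c < 1" and pos: "\<And>x. gen_hahn_I_weight \<alpha>\<^sub>1 \<alpha>\<^sub>2 \<beta> c x > 0"
  shows "(\<lambda>N. \<Sum>x. real x ^ k * gen_hahn_II_weight \<alpha>\<^sub>1 \<alpha>\<^sub>2 (- real N) \<beta> (- real N / c) x)
           \<longlonglongrightarrow> (\<Sum>x. real x ^ k * gen_hahn_I_weight \<alpha>\<^sub>1 \<alpha>\<^sub>2 \<beta> c x)"
proof -
  let ?w = "gen_hahn_I_weight \<alpha>\<^sub>1 \<alpha>\<^sub>2 \<beta> c"
  let ?wN = "\<lambda>N. gen_hahn_II_weight \<alpha>\<^sub>1 \<alpha>\<^sub>2 (- real N) \<beta> (- real N / c)"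
  let ?q = "\<lambda>N x. pochhammer (- real N) x / pochhammer (- real N / c + 1) x / c ^ x"
  have eq: "?wN N x = ?w x * ?q N x" for N x
    using c by (intro gen_hahn_II_weight_eq) simp
  \<comment> \<open>\<open>J\<close> depends on \<open>c\<close> alone, so the constant
    \<open>K\<close> is uniform in both \<open>N\<close> and \<open>x\<close>.\<close>
  obtain J :: nat where J: "c / (1 - c) \<le> real J"
    using real_arch_simple by blast
  define K where "K = (1 / (1 - c)) ^ J"
  have K: "K \<ge> 0" using c by (simp add: K_def)
  have bound: "norm (real x ^ k * ?wN N x) \<le> K * (real x ^ k * ?w x)" for N x
  proof (cases "x \<le> N")
    case True
    have "real x ^ k * (?w x * ?q N x) \<le> real x ^ k * (?w x * K)"
      using hahn_ratio_le[OF c J True] pos[of x]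
      by (intro mult_left_mono) (auto simp: K_def less_imp_le)
    moreover have "?wN N x > 0"
      unfolding eq using hahn_ratio_pos[OF c True] pos[of x] by (intro mult_pos_pos)
    ultimately show ?thesis
      unfolding eq[symmetric] by (simp add: abs_mult mult.commute mult.left_commute)
  next
    case False
    then show ?thesis
      using gen_hahn_II_weight_eq_0[of N x] K pos[of x] by (simp add: less_imp_le)
  qed
  have "(\<lambda>N. real x ^ k * (?w x * ?q N x)) \<longlonglongrightarrow> real x ^ k * (?w x * 1)" for x
    by (intro tendsto_intros tendsto_hahn_ratio c)
  then have lim: "(\<lambda>N. real x ^ k * ?wN N x) \<longlonglongrightarrow> real x ^ k * ?w x" for x
    by (simp only: eq mult_1_right)
  have "summable (\<lambda>x. K * (real x ^ k * ?w x))"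
    by (intro summable_mult summable_gen_hahn_I_moment c)
  moreover have "eventually (\<lambda>(x, N). norm (real x ^ k * ?wN N x) \<le> K * (real x ^ k * ?w x))
      (at_top \<times>\<^sub>F sequentially)"
    using bound by (intro always_eventually) auto
  ultimately show ?thesis
    using tannerys_theorem[where a = "\<lambda>x N. real x ^ k * ?wN N x", OF lim] by simp
qed

theorem mainTheorem1:
  fixes \<alpha>\<^sub>1 \<alpha>\<^sub>2 \<beta> c x :: real and n :: nat
  assumes "0 < c" and "c < 1"
    and "\<beta> + 1 \<notin> \<int>\<^sub>\<le>\<^sub>0"
    and "\<alpha>\<^sub>1 * \<alpha>\<^sub>2 * (\<beta> + 1) > 0"
    and "\<forall>k. gen_hahn_I_weight \<alpha>\<^sub>1 \<alpha>\<^sub>2 \<beta> c k > 0"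
  shows "(\<lambda>N. poly (gen_hahn_II \<alpha>\<^sub>1 \<alpha>\<^sub>2 N \<beta> (- real N / c) n) x)
           \<longlonglongrightarrow> poly (gen_hahn_I \<alpha>\<^sub>1 \<alpha>\<^sub>2 \<beta> c n) x"
proof -
  let ?w = "gen_hahn_I_weight \<alpha>\<^sub>1 \<alpha>\<^sub>2 \<beta> c"
  let ?wN = "\<lambda>N. gen_hahn_II_weight \<alpha>\<^sub>1 \<alpha>\<^sub>2 (- real N) \<beta> (- real N / c)"
  have pos: "?w k > 0" for k using assms by blast
  show ?thesis
    unfolding gen_hahn_I_def gen_hahn_II_def
  proof (rule tendsto_monic_OP)
    \<comment> \<open>Nonnegativity of the terms turns the convergent series into an unconditional
      sum.\<close>
    show "((\<lambda>x. real x ^ k * ?w x) has_sum (\<Sum>x. real x ^ k * ?w x)) UNIV" for k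
      using summable_gen_hahn_I_moment[OF assms(1,2)] pos
      by (intro sums_nonneg_imp_has_sum summable_sums) (auto simp: less_imp_le)
    show "((\<lambda>x. real x ^ k * ?wN N x) has_sum (\<Sum>x. real x ^ k * ?wN N x)) {0..N}" for N k
      by (intro has_sum_finiteI suminf_finite) (auto simp: gen_hahn_II_weight_eq_0)
    have "?wN N x > 0" if "x \<le> N" for x N
      unfolding gen_hahn_II_weight_eq[OF less_imp_neq[OF assms(1), symmetric]]
      by (intro mult_pos_pos pos hahn_ratio_pos assms that)
    then show "\<forall>\<^sub>F N in sequentially. \<forall>x\<in>{0..N}. ?wN N x > 0"
      by simp
    \<comment> \<open>The support has N + 1 points, so N \<ge> n suffices.\<close>
    show "\<forall>\<^sub>F N in sequentially. infinite {0..N} \<or> n < card {0..N}"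
      using eventually_ge_at_top[of n] by eventually_elim simp
    show "(\<lambda>N. \<Sum>x. real x ^ k * ?wN N x) \<longlonglongrightarrow> (\<Sum>x. real x ^ k * ?w x)" for k
      using gen_hahn_II_moment_tendsto[OF assms(1,2) pos] .
  qed (use pos in auto)
qed

end
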